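(* Let $\mathcal{D}$ be a distribution on $\mathbb{R}^p\times\{-1,+1\}$ with $\mathbb{E}_{(\mathbf{x},y)\sim\mathcal{D}}[\|\mathbf{x}\|_2^2]<+\infty$, and $\Sigma:=\mathbb{E}[\mathbf{x}\mathbf{x}^T]$. Suppose that SGD for the logistic loss $L_{\mathcal{D}}$ is initialized at $\beta^0:=0$ and run with constant step-size $\bar\alpha>0$, with stochastic gradients computed by independently sampling from $\mathcal{D}$. Under either Option A or Option B for the output $\hat\beta^k$, if the data distribution $\mathcal{D}$ is non-separable, then for all $k\ge0$ it holds that $$\mathbb{E}\big[L_{\mathcal{D}}(\hat\beta^k)\big]-L_{\mathcal{D}}^*\ \le\ \frac{(\ln(2))^2}{2\bar\alpha(k+1)\cdot(\mathrm{DegNSEP}^*_{\mathcal{D}})^2}+\frac{\bar\alpha\cdot\mathrm{Tr}(\Sigma)}{2}.$$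
   Context: Let $\ell(t):=\ln(1+\exp(-t))$, $L_{\mathcal{D}}(\beta):=\mathbb{E}_{(\mathbf{x},y)\sim\mathcal{D}}[\ell(y\beta^T\mathbf{x})]$ for $\beta\in\mathbb{R}^p$, and $L_{\mathcal{D}}^*:=\inf_\beta L_{\mathcal{D}}(\beta)$. $\mathcal{D}$ is separable if there is $\beta$ with $\inf_{(\mathbf{x},y)\in\mathrm{supp}(\mathcal{D})}y\beta^T\mathbf{x}>0$, and non-separable otherwise. With $[t]^-:=\max\{-t,0\}$ and the $\ell_2$ norm, $$\mathrm{DegNSEP}^*_{\mathcal{D}}:=\min_{\|\beta\|_2=1}\mathbb{E}_{(\mathbf{x},y)\sim\mathcal{D}}\big[[y\beta^T\mathbf{x}]^-\big].$$ If $\mathrm{DegNSEP}^*_{\mathcal{D}}=0$ the right-hand side of the bound is read as $+\infty$. SGD with constant step-size $\bar\alpha$: at iteration $i\ge0$ draw $(\tilde{\mathbf{x}},\tilde y)\sim\mathcal{D}$ independently of everything before, set $\tilde\nabla L_{\mathcal{D}}(\beta^i):=\nabla_\beta\ell(\tilde y\beta^T\tilde{\mathbf{x}})|_{\beta=\beta^i}$, and $\beta^{i+1}:=\beta^i-\bar\alpha\,\tilde\nabla L_{\mathcal{D}}(\beta^i)$. After $k$ iterations the output is, under Option A, $\hat\beta^k:=\frac1{k+1}\sum_{i=0}^k\beta^i$; under Option B, $\hat\beta^k:=\beta^{I_k}$ where $I_k$ is uniform on $\{0,1,\ldots,k\}$ and independent of $\beta^0,\ldots,\beta^k$. The expectation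 is over all randomness in the algorithm. *)

theory Defs
  imports "HOL-Probability.Probability"
begin

text \<open>
  A distribution on $R^p \times \{-1,+1\}$. Labels have type \<open>real\<close>, so that they can be
  multiplied with inner products, but the underlying space is exactly \<open>UNIV \<times> {- 1, 1}\<close>.
\<close>

definition labelled_space :: "((real ^ 'p) \<times> real) measure" where
  "labelled_space = borel \<Otimes>\<^sub>M count_space {- 1, 1}"

definition data_distribution :: "((real ^ 'p) \<times> real) measure \<Rightarrow> bool" where
  "data_distribution D \<longleftrightarrow> prob_space D \<and> sets D = sets labelled_space"

definition logistic_loss :: "real \<Rightarrow> real" where
  "logistic_loss t = ln (1 + exp (- t))"

definition logistic_risk :: "((real ^ 'p) \<times> real) measure \<Rightarrow> real ^ 'p \<Rightarrow> real" where
  "logistic_risk D \<beta> = (\<integral>(x, y). logistic_loss (y * (\<beta> \<bullet> x)) \<partial>D)"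

definition optimal_logistic_risk :: "((real ^ 'p) \<times> real) measure \<Rightarrow> real" where
  "optimal_logistic_risk D = (INF \<beta>. logistic_risk D \<beta>)"

text \<open>
  The topological support, relative to \<open>space D\<close>: for a data distribution the intersections
  \<open>U \<inter> space D\<close> are the open subsets of \<open>UNIV \<times> {- 1, 1}\<close>.
\<close>

definition measure_support :: "'a::topological_space measure \<Rightarrow> 'a set" where
  "measure_support D =
    {z \<in> space D. \<forall>U. open U \<and> z \<in> U \<longrightarrow> emeasure D (U \<inter> space D) > 0}"

text \<open>
  The infimum is taken in \<open>ereal\<close> because the margins may be unbounded below, where the
  infimum of a set of reals is unspecified.
\<close>

definition separable :: "((real ^ 'p) \<times> real) measure \<Rightarrow> bool" where
  "separable D \<longleftrightarrow>
    (\<exists>\<beta>. (INF (x, y) \<in> measure_support D. ereal (y * (\<beta> \<bullet> x))) > 0)"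

definition neg_part :: "real \<Rightarrow> real" where
  "neg_part t = max (- t) 0"

text \<open>
  \<open>DegNSEP\<close> is written as an infimum; \<open>DegNSEP_is_min\<close> below shows that it is attained when
  the features are square-integrable.
\<close>

definition DegNSEP :: "((real ^ 'p) \<times> real) measure \<Rightarrow> real" where
  "DegNSEP D = (INF \<beta> \<in> sphere 0 1. \<integral>(x, y). neg_part (y * (\<beta> \<bullet> x)) \<partial>D)"

definition second_moment_matrix :: "((real ^ 'p) \<times> real) measure \<Rightarrow> real ^ 'p ^ 'p" where
  "second_moment_matrix D = (\<integral>(x, y). (\<chi> i j. x $ i * x $ j) \<partial>D)"

definition gradient :: "('a::real_inner \<Rightarrow> real) \<Rightarrow> 'a \<Rightarrow> 'a" where
  "gradient f \<beta> = (THE g. GDERIV f \<beta> :> g)"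

definition stochastic_gradient :: "(real ^ 'p) \<times> real \<Rightarrow> real ^ 'p \<Rightarrow> real ^ 'p" where
  "stochastic_gradient z = gradient (\<lambda>\<beta>. case z of (x, y) \<Rightarrow> logistic_loss (y * (\<beta> \<bullet> x)))"

text \<open>The SGD iterates from the origin, where \<open>z i\<close> is the sample drawn at iteration \<open>i\<close>.\<close>

primrec sgd :: "real \<Rightarrow> (nat \<Rightarrow> (real ^ 'p) \<times> real) \<Rightarrow> nat \<Rightarrow> real ^ 'p" where
  "sgd \<alpha> z 0 = 0"
| "sgd \<alpha> z (Suc i) = sgd \<alpha> z i - \<alpha> *\<^sub>R stochastic_gradient (z i) (sgd \<alpha> z i)"

definition sgd_average :: "real \<Rightarrow> (nat \<Rightarrow> (real ^ 'p) \<times> real) \<Rightarrow> nat \<Rightarrow> real ^ 'p" where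
  "sgd_average \<alpha> z k = (1 / (real k + 1)) *\<^sub>R (\<Sum>i=0..k. sgd \<alpha> z i)"

text \<open>\<open>Z\<close> is a sequence of independent samples from \<open>D\<close>, on the probability space \<open>P\<close>.\<close>

definition iid_samples ::
  "'w measure \<Rightarrow> ((real ^ 'p) \<times> real) measure \<Rightarrow> (nat \<Rightarrow> 'w \<Rightarrow> (real ^ 'p) \<times> real) \<Rightarrow> bool" where
  "iid_samples P D Z \<longleftrightarrow>
    prob_space P \<and> prob_space.indep_vars P (\<lambda>_. D) Z UNIV \<and> (\<forall>i. distr P D (Z i) = D)"

text \<open>
  \<open>I\<close> is uniform on \<open>{0..k}\<close> and independent of the random vector \<open>(b 0, \<dots>, b k)\<close>.
  Independence is that of the generated \<open>\<sigma>\<close>-algebras, since \<open>indep_var\<close> needs both variables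
  to have the same value type.
\<close>

definition uniform_index ::
  "'w measure \<Rightarrow> (nat \<Rightarrow> 'w \<Rightarrow> real ^ 'p) \<Rightarrow> nat \<Rightarrow> ('w \<Rightarrow> nat) \<Rightarrow> bool" where
  "uniform_index P b k I \<longleftrightarrow>
    I \<in> measurable P (count_space UNIV) \<and>
    distr P (count_space UNIV) I = measure_pmf (pmf_of_set {0..k}) \<and>
    prob_space.indep_set P
      (sets (vimage_algebra (space P) (\<lambda>\<omega>. \<lambda>i\<in>{0..k}. b i \<omega>) (Pi\<^sub>M {0..k} (\<lambda>_. borel))))
      (sets (vimage_algebra (space P) I (count_space UNIV)))"

text \<open>
  The right-hand side of the bound. The quotient is taken in \<open>ereal\<close>, where dividing a positive
  number by 0 gives \<open>\<infinity>\<close>.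
\<close>

definition sgd_bound :: "((real ^ 'p) \<times> real) measure \<Rightarrow> real \<Rightarrow> nat \<Rightarrow> ereal" where
  "sgd_bound D \<alpha> k =
    ereal ((ln 2)\<^sup>2) / ereal (2 * \<alpha> * (real k + 1) * (DegNSEP D)\<^sup>2)
      + ereal (\<alpha> * trace (second_moment_matrix D) / 2)"

lemma sgd_bound_infinite: "DegNSEP D = 0 \<Longrightarrow> sgd_bound D \<alpha> k = \<infinity>"
  by (simp add: sgd_bound_def divide_ereal_def)

lemma GDERIV_unique:
  assumes "GDERIV f x :> g" "GDERIV f x :> h"
  shows "g = h"
proof -
  have "(\<lambda>v. v \<bullet> g) = (\<lambda>v. v \<bullet> h)"
    using assms unfolding gderiv_def by (rule has_derivative_unique)
  then have "\<forall>v. v \<bullet> g = v \<bullet> h"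
    by (auto dest: fun_cong)
  then show ?thesis
    by (simp only: vector_eq_ldot)
qed

lemma gradient_eqI: "GDERIV f x :> g \<Longrightarrow> gradient f x = g"
  unfolding gradient_def by (rule the_equality, assumption, rule GDERIV_unique)

lemma stochastic_gradient_eq:
  "stochastic_gradient (x, y) \<beta> = - (y / (1 + exp (y * (\<beta> \<bullet> x)))) *\<^sub>R x"
  unfolding stochastic_gradient_def
proof (rule gradient_eqI)
  have 1: "GDERIV (\<lambda>\<beta>. y * (\<beta> \<bullet> x)) \<beta> :> y *\<^sub>R x"
    unfolding gderiv_def by (auto intro!: derivative_eq_intros simp: inner_scaleR_right)
  have "(logistic_loss has_field_derivative (- exp (- t) / (1 + exp (- t)))) (at t)" for t
    unfolding logistic_loss_def
    by (auto intro!: derivative_eq_intros simp: add_pos_pos)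
  moreover have "- exp (- t) / (1 + exp (- t)) = - (1 / (1 + exp t))" for t :: real
    by (simp add: exp_minus field_simps add_pos_pos add_eq_0_iff)
  ultimately have 2: "(logistic_loss has_field_derivative (- (1 / (1 + exp t)))) (at t)" for t
    by metis
  have "GDERIV (\<lambda>\<beta>. logistic_loss (y * (\<beta> \<bullet> x))) \<beta> :>
      (- (1 / (1 + exp (y * (\<beta> \<bullet> x))))) *\<^sub>R (y *\<^sub>R x)"
    using GDERIV_DERIV_compose[OF 1 2] .
  then show "GDERIV (\<lambda>\<beta>. case (x, y) of (x, y) \<Rightarrow> logistic_loss (y * (\<beta> \<bullet> x))) \<beta> :>
      - (y / (1 + exp (y * (\<beta> \<bullet> x)))) *\<^sub>R x"
    by (simp add: mult.commute)
qed

lemma DegNSEP_is_min: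
  fixes D :: "((real ^ 'p) \<times> real) measure"
  assumes D: "data_distribution D" and sq: "integrable D (\<lambda>(x, y). (norm x)\<^sup>2)"
  obtains \<beta> where "norm \<beta> = 1" "DegNSEP D = (\<integral>(x, y). neg_part (y * (\<beta> \<bullet> x)) \<partial>D)"
    and "\<And>\<gamma>. norm \<gamma> = 1 \<Longrightarrow> DegNSEP D \<le> (\<integral>(x, y). neg_part (y * (\<gamma> \<bullet> x)) \<partial>D)"
proof -
  interpret prob_space D
    using D by (simp add: data_distribution_def)
  have sD: "sets D = sets (borel \<Otimes>\<^sub>M count_space {- 1, 1})"
    using D by (simp add: data_distribution_def labelled_space_def)
  have space: "space D = UNIV \<times> {- 1, 1}"
    using sets_eq_imp_space_eq[OF sD] by (simp add: space_pair_measure)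
  have [measurable]: "fst \<in> borel_measurable D"
    unfolding measurable_cong_sets[OF sD refl] by (rule measurable_fst)
  have "(\<lambda>y::real. y) \<in> borel_measurable (count_space {- 1, 1})"
    by simp
  then have [measurable]: "snd \<in> borel_measurable D"
    unfolding measurable_cong_sets[OF sD refl] by (rule measurable_compose[OF measurable_snd])
  define F where "F \<beta> z = neg_part (snd z * (\<beta> \<bullet> fst z))" for \<beta> and z :: "(real ^ 'p) \<times> real"
  define f where "f \<beta> = (\<integral>z. F \<beta> z \<partial>D)" for \<beta>
  have [measurable]: "F \<beta> \<in> borel_measurable D" for \<beta>
    unfolding F_def neg_part_def by measurable
  have int: "integrable D (\<lambda>z. norm (fst z))"
  proof (rule Bochner_Integration.integrable_bound)
    show "integrable D (\<lambda>z. 1 + (norm (fst z))\<^sup>2)"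
      using sq by (simp add: case_prod_beta')
    have "\<bar>norm (fst z)\<bar> \<le> \<bar>1 + (norm (fst z))\<^sup>2\<bar>" for z :: "(real ^ 'p) \<times> real"
    proof -
      have "0 \<le> (norm (fst z) - 1)\<^sup>2"
        by simp
      then have "2 * norm (fst z) \<le> 1 + (norm (fst z))\<^sup>2"
        by (simp add: power2_diff)
      then show ?thesis
        by (smt (verit) norm_ge_zero)
    qed
    then show "AE z in D. norm (norm (fst z)) \<le> norm (1 + (norm (fst z))\<^sup>2)"
      by simp
  qed measurable
  have lip: "\<bar>F \<beta> z - F \<gamma> z\<bar> \<le> norm (\<beta> - \<gamma>) * norm (fst z)" if "z \<in> space D" for \<beta> \<gamma> z
  proof -
    have "\<bar>F \<beta> z - F \<gamma> z\<bar> \<le> \<bar>snd z * (\<beta> \<bullet> fst z) - snd z * (\<gamma> \<bullet> fst z)\<bar>"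
      unfolding F_def neg_part_def by linarith
    also have "\<dots> = \<bar>(\<beta> - \<gamma>) \<bullet> fst z\<bar>"
      using that by (auto simp: space inner_diff_left)
    also have "\<dots> \<le> norm (\<beta> - \<gamma>) * norm (fst z)"
      by (rule Cauchy_Schwarz_ineq2)
    finally show ?thesis .
  qed
  have intF: "integrable D (F \<beta>)" for \<beta>
  proof (rule Bochner_Integration.integrable_bound)
    show "integrable D (\<lambda>z. norm \<beta> * norm (fst z))"
      using int by simp
    show "AE z in D. norm (F \<beta> z) \<le> norm (norm \<beta> * norm (fst z))"
      using lip[of _ \<beta> 0] by (auto simp: F_def neg_part_def)
  qed measurable
  have "\<bar>f \<beta> - f \<gamma>\<bar> \<le> norm (\<beta> - \<gamma>) * (\<integral>z. norm (fst z) \<partial>D)" for \<beta> \<gamma>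
  proof -
    have "\<bar>f \<beta> - f \<gamma>\<bar> = \<bar>\<integral>z. F \<beta> z - F \<gamma> z \<partial>D\<bar>"
      by (simp add: f_def intF)
    also have "\<dots> \<le> (\<integral>z. norm (\<beta> - \<gamma>) * norm (fst z) \<partial>D)"
    proof -
      have "\<bar>\<integral>z. F \<beta> z - F \<gamma> z \<partial>D\<bar> \<le> (\<integral>z. \<bar>F \<beta> z - F \<gamma> z\<bar> \<partial>D)"
        by (rule integral_abs_bound)
      also have "\<dots> \<le> (\<integral>z. norm (\<beta> - \<gamma>) * norm (fst z) \<partial>D)"
        using int intF lip by (intro integral_mono) auto
      finally show ?thesis .
    qed
    finally show ?thesis
      by simp
  qed
  then have "(\<integral>z. norm (fst z) \<partial>D)-lipschitz_on (sphere 0 1) f"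
    by (intro lipschitz_onI) (auto simp: dist_norm mult.commute)
  then have "continuous_on (sphere 0 1) f"
    by (rule lipschitz_on_continuous_on)
  moreover have "sphere (0 :: real ^ 'p) 1 \<noteq> {}"
    by simp
  ultimately obtain \<beta> where \<beta>: "\<beta> \<in> sphere 0 1" "\<And>\<gamma>. \<gamma> \<in> sphere 0 1 \<Longrightarrow> f \<beta> \<le> f \<gamma>"
    using continuous_attains_inf[OF compact_sphere] by metis
  then have "Inf (f ` sphere 0 1) = f \<beta>"
    by (intro cInf_eq_minimum) auto
  then have "DegNSEP D = f \<beta>"
    by (simp add: DegNSEP_def f_def F_def case_prod_beta')
  with \<beta> that show ?thesis
    by (simp add: f_def F_def case_prod_beta')
qed

end

theory Submission
  imports Defs
begin

text \<open>
  For every comparison point \<open>\<gamma>\<close>, convexity of the loss and the SGD recursion telescope along each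
  path to
  \<open>2 \<alpha> (\<Sum>i\<le>k. \<ell>\<^sub>i(\<beta>\<^sub>i) - \<ell>\<^sub>i(\<gamma>)) \<le> \<parallel>\<gamma>\<parallel>\<^sup>2 + \<alpha>\<^sup>2 (\<Sum>i\<le>k. \<parallel>x\<^sub>i\<parallel>\<^sup>2)\<close>;
  since \<open>\<beta>\<^sub>i\<close> is independent of the \<open>i\<close>-th sample, taking expectations bounds the average of
  \<open>E[L(\<beta>\<^sub>i)]\<close> by \<open>L(\<gamma>) + \<parallel>\<gamma>\<parallel>\<^sup>2 / (2 \<alpha> (k + 1)) + \<alpha> Tr \<Sigma> / 2\<close>. As the loss dominates the
  negative part, \<open>L(\<gamma>) \<ge> DegNSEP * \<parallel>\<gamma>\<parallel>\<close>, so that \<open>\<parallel>\<gamma>\<parallel> \<le> ln 2 / DegNSEP\<close> whenever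
  \<open>L(\<gamma>) \<le> ln 2 = L(0)\<close>; for all other \<open>\<gamma>\<close> one compares with the origin instead. No minimiser of the
  risk is needed. The averaged output is handled by Jensen's inequality, and the random index by its
  independence of the iterates.
\<close>

section \<open>The logistic loss: growth, derivatives and convexity\<close>

lemma logistic_loss_nonneg: "0 \<le> logistic_loss t"
  by (simp add: logistic_loss_def)

lemma logistic_loss_0: "logistic_loss 0 = ln 2"
  by (simp add: logistic_loss_def)

lemma neg_part_le_logistic_loss: "neg_part t \<le> logistic_loss t"
proof -
  have "- t = ln (exp (- t))"
    by simp
  also have "\<dots> \<le> logistic_loss t"
    unfolding logistic_loss_def by (subst ln_le_cancel_iff) (auto simp: add_pos_pos)
  finally show ?thesis
    using logistic_loss_nonneg[of t] by (simp add: neg_part_def)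
qed

text \<open>Both \<open>1\<close> and \<open>exp (- t)\<close> are at most
  \<open>exp \<bar>t\<bar>\<close>. The resulting linear growth makes the loss integrable as soon as
  the feature norm is.\<close>

lemma logistic_loss_le: "logistic_loss t \<le> ln 2 + \<bar>t\<bar>"
proof -
  have "exp (- t) \<le> exp \<bar>t\<bar>" "1 \<le> exp \<bar>t\<bar>"
    by auto
  then have "1 + exp (- t) \<le> 2 * exp \<bar>t\<bar>"
    by linarith
  then have "logistic_loss t \<le> ln (2 * exp \<bar>t\<bar>)"
    unfolding logistic_loss_def by (subst ln_le_cancel_iff) (auto simp: add_pos_pos)
  then show ?thesis
    by (simp add: ln_mult)
qed

lemma logistic_loss_has_derivative:
  "(logistic_loss has_field_derivative - (1 / (1 + exp t))) (at t)"
proof -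
  have "(logistic_loss has_field_derivative (- exp (- t) / (1 + exp (- t)))) (at t)"
    unfolding logistic_loss_def by (auto intro!: derivative_eq_intros simp: add_pos_pos)
  moreover have "- exp (- t) / (1 + exp (- t)) = - (1 / (1 + exp t))"
    by (simp add: exp_minus field_simps add_pos_pos add_eq_0_iff)
  ultimately show ?thesis
    by simp
qed

lemma logistic_slope_has_derivative:
  "((\<lambda>t::real. - (1 / (1 + exp t))) has_field_derivative exp t / (1 + exp t)\<^sup>2) (at t)"
proof -
  have "1 + exp t \<noteq> 0"
    by (smt (verit) exp_gt_zero)
  then show ?thesis
    by (auto intro!: derivative_eq_intros simp: power2_eq_square)
qed

lemma convex_logistic_loss: "convex_on UNIV logistic_loss"
  by (rule f''_ge0_imp_convex[OF _ logistic_loss_has_derivative logistic_slope_has_derivative]) auto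

text \<open>A nonnegative second derivative keeps the graph above its tangent at \<open>s\<close>.
  This is the form in which convexity enters the SGD analysis.\<close>

lemma logistic_loss_tangent: "- (1 / (1 + exp s)) * (t - s) \<le> logistic_loss t - logistic_loss s"
  by (rule f''_imp_f'[OF _ logistic_loss_has_derivative logistic_slope_has_derivative, of UNIV]) auto

lemma borel_measurable_logistic_loss [measurable]: "logistic_loss \<in> borel_measurable borel"
  unfolding logistic_loss_def by measurable

section \<open>The loss of one sample and its gradient\<close>

text \<open>The integrand of the risk, written with projections rather than a case expression so
  that the sample and the parameter can both be random variables in measurability arguments.\<close>

definition sample_loss :: "(real ^ 'p) \<times> real \<Rightarrow> real ^ 'p \<Rightarrow> real" where
  "sample_loss z \<beta> = logistic_loss (snd z * (\<beta> \<bullet> fst z))"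

lemma sample_loss_nonneg: "0 \<le> sample_loss z \<beta>"
  by (simp add: sample_loss_def logistic_loss_nonneg)

lemma logistic_risk_eq: "logistic_risk D \<beta> = (\<integral>z. sample_loss z \<beta> \<partial>D)"
  by (simp add: logistic_risk_def sample_loss_def case_prod_beta')

lemma sample_loss_le:
  assumes "\<bar>snd z\<bar> = 1"
  shows "sample_loss z \<beta> \<le> ln 2 + norm \<beta> * norm (fst z)"
proof -
  have "\<bar>snd z * (\<beta> \<bullet> fst z)\<bar> \<le> norm \<beta> * norm (fst z)"
    using assms by (simp add: abs_mult Cauchy_Schwarz_ineq2)
  then show ?thesis
    unfolding sample_loss_def using logistic_loss_le[of "snd z * (\<beta> \<bullet> fst z)"] by linarith
qed

text \<open>The margin is linear in the parameter, so this is Jensen's inequality for the logistic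
  loss with \<open>k + 1\<close> equal weights.\<close>

lemma sample_loss_average:
  fixes b :: "nat \<Rightarrow> real ^ 'p"
  shows "sample_loss z ((1 / (real k + 1)) *\<^sub>R (\<Sum>i=0..k. b i))
    \<le> (\<Sum>i=0..k. sample_loss z (b i)) / (real k + 1)"
proof -
  have "logistic_loss (\<Sum>i=0..k. (1 / (real k + 1)) *\<^sub>R (snd z * (b i \<bullet> fst z)))
      \<le> (\<Sum>i=0..k. (1 / (real k + 1)) * logistic_loss (snd z * (b i \<bullet> fst z)))"
    by (rule convex_on_sum[OF _ _ convex_logistic_loss]) auto
  then show ?thesis
    by (simp add: sample_loss_def inner_sum_left sum_divide_distrib sum_distrib_left mult.assoc
        mult.left_commute)
qed

lemma stochastic_gradient_eq':
  "stochastic_gradient z \<beta> = - (snd z / (1 + exp (snd z * (\<beta> \<bullet> fst z)))) *\<^sub>R fst z"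
  using stochastic_gradient_eq[of "fst z" "snd z"] by simp

text \<open>The tangent inequality at the two margins; by the chain rule the slope times the margin
  difference is the inner product with the gradient.\<close>

lemma sample_loss_diff_le:
  "sample_loss z \<beta> - sample_loss z \<gamma> \<le> stochastic_gradient z \<beta> \<bullet> (\<beta> - \<gamma>)"
  using logistic_loss_tangent[of "snd z * (\<beta> \<bullet> fst z)" "snd z * (\<gamma> \<bullet> fst z)"]
  by (simp add: sample_loss_def stochastic_gradient_eq' inner_diff_right inner_commute
      algebra_simps diff_divide_distrib)

text \<open>The logistic slope is less than 1 in absolute value, so with a label of absolute value 1
  the gradient is a multiple of the feature vector by a factor of at most 1.\<close>

lemma norm_stochastic_gradient_le:
  assumes "\<bar>snd z\<bar> = 1"
  shows "norm (stochastic_gradient z \<beta>) \<le> norm (fst z)"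
proof -
  define e where "e = exp (snd z * (\<beta> \<bullet> fst z))"
  have "0 < e"
    by (simp add: e_def)
  then have "\<bar>snd z / (1 + e)\<bar> \<le> 1"
    using assms by (simp add: abs_divide)
  then have "\<bar>snd z / (1 + e)\<bar> * norm (fst z) \<le> 1 * norm (fst z)"
    by (rule mult_right_mono) simp
  then show ?thesis
    by (simp add: stochastic_gradient_eq' e_def)
qed

section \<open>Pathwise inequalities for SGD\<close>

text \<open>Expanding the squared distance to \<gamma> after one step gives a cross term, which
  dominates the loss difference by convexity, and a quadratic term, which the gradient bound
  controls.\<close>

lemma sgd_step_le:
  assumes "\<alpha> > 0" "\<bar>snd z\<bar> = 1"
  shows "2 * \<alpha> * (sample_loss z \<beta> - sample_loss z \<gamma>)
    \<le> (norm (\<beta> - \<gamma>))\<^sup>2 - (norm (\<beta> - \<alpha> *\<^sub>R stochastic_gradient z \<beta> - \<gamma>))\<^sup>2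
       + \<alpha>\<^sup>2 * (norm (fst z))\<^sup>2"
proof -
  define g where "g = stochastic_gradient z \<beta>"
  have "(norm (\<beta> - \<alpha> *\<^sub>R g - \<gamma>))\<^sup>2
      = (norm (\<beta> - \<gamma>))\<^sup>2 - 2 * \<alpha> * (g \<bullet> (\<beta> - \<gamma>)) + \<alpha>\<^sup>2 * (norm g)\<^sup>2"
    unfolding power2_norm_eq_inner
    by (simp add: inner_diff_left inner_diff_right inner_commute algebra_simps power2_eq_square)
  moreover have "2 * \<alpha> * (sample_loss z \<beta> - sample_loss z \<gamma>) \<le> 2 * \<alpha> * (g \<bullet> (\<beta> - \<gamma>))"
    using sample_loss_diff_le[of z \<beta> \<gamma>] assms by (simp add: g_def)
  moreover have "\<alpha>\<^sup>2 * (norm g)\<^sup>2 \<le> \<alpha>\<^sup>2 * (norm (fst z))\<^sup>2"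
    using norm_stochastic_gradient_le[OF assms(2), of \<beta>]
    by (intro mult_left_mono power_mono) (auto simp: g_def)
  ultimately show ?thesis
    unfolding g_def by linarith
qed

text \<open>The one-step inequalities telescope. The final squared distance stays on the left so
  that the induction closes; the initial one is \<open>(norm \<gamma>)\<^sup>2\<close> because the
  path starts at the origin.\<close>

lemma sgd_telescope:
  assumes "\<alpha> > 0" "\<And>i. \<bar>snd (z i)\<bar> = 1"
  shows "2 * \<alpha> * (\<Sum>i<n. sample_loss (z i) (sgd \<alpha> z i) - sample_loss (z i) \<gamma>)
      + (norm (sgd \<alpha> z n - \<gamma>))\<^sup>2
    \<le> (norm \<gamma>)\<^sup>2 + \<alpha>\<^sup>2 * (\<Sum>i<n. (norm (fst (z i)))\<^sup>2)"
proof (induction n)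
  case (Suc n)
  then show ?case
    using sgd_step_le[OF assms(1) assms(2), of n "sgd \<alpha> z n" \<gamma>] by (simp add: distrib_left)
qed simp

text \<open>Each step moves the iterate by at most \<alpha> times the feature norm. This crude
  growth bound provides the integrability of risks and losses along the path.\<close>

lemma norm_sgd_le:
  assumes "\<alpha> > 0" "\<And>i. \<bar>snd (z i)\<bar> = 1"
  shows "norm (sgd \<alpha> z n) \<le> \<alpha> * (\<Sum>i<n. norm (fst (z i)))"
proof (induction n)
  case (Suc n)
  have "norm (sgd \<alpha> z (Suc n)) \<le> norm (sgd \<alpha> z n) + norm (\<alpha> *\<^sub>R stochastic_gradient (z n) (sgd \<alpha> z n))"
    unfolding sgd.simps by (rule norm_triangle_ineq4)
  also have "norm (\<alpha> *\<^sub>R stochastic_gradient (z n) (sgd \<alpha> z n)) \<le> \<alpha> * norm (fst (z n))"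
    using norm_stochastic_gradient_le[OF assms(2)] assms(1) by simp
  finally show ?case
    using Suc by (simp add: distrib_left)
qed simp

text \<open>Iterate \<open>n\<close> is a function of the samples before \<open>n\<close>; this is
  the source of its independence from sample \<open>n\<close>.\<close>

lemma sgd_cong: "(\<And>i. i < n \<Longrightarrow> z i = z' i) \<Longrightarrow> sgd \<alpha> z n = sgd \<alpha> z' n"
  by (induction n) auto

section \<open>Generated sigma-algebras and expectations over independent pairs\<close>

lemma sigma_sets_vimage_subset:
  assumes "f \<in> measurable M N"
  shows "sigma_sets (space M) {f -` A \<inter> space M | A. A \<in> sets N} \<subseteq> sets M"
  using assms by (simp add: measurable_iff_sets sets_vimage_algebra)

text \<open>Independence makes the joint law a product, so Fubini applies; pulling the marginals
  back to \<open>M\<close> lets \<omega>' play the part of an independent copy of the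
  randomness.\<close>

lemma (in prob_space) integral_indep_var_pair:
  fixes h :: "'b \<times> 'b \<Rightarrow> real"
  assumes ind: "indep_var N X N' Y"
    and [measurable]: "h \<in> borel_measurable (N \<Otimes>\<^sub>M N')"
    and int: "integrable M (\<lambda>\<omega>. h (X \<omega>, Y \<omega>))"
  shows "(\<integral>\<omega>. h (X \<omega>, Y \<omega>) \<partial>M) = (\<integral>\<omega>. (\<integral>\<omega>'. h (X \<omega>, Y \<omega>') \<partial>M) \<partial>M)"
proof -
  note [measurable] = indep_var_rv1[OF ind] indep_var_rv2[OF ind]
  interpret X: prob_space "distr M N X"
    by (rule prob_space_distr) measurable
  interpret Y: prob_space "distr M N' Y"
    by (rule prob_space_distr) measurable
  interpret XY: pair_prob_space "distr M N X" "distr M N' Y" ..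
  have eq: "distr M N X \<Otimes>\<^sub>M distr M N' Y = distr M (N \<Otimes>\<^sub>M N') (\<lambda>\<omega>. (X \<omega>, Y \<omega>))"
    using ind by (simp add: indep_var_distribution_eq)
  have "integrable (distr M N X \<Otimes>\<^sub>M distr M N' Y) h"
    unfolding eq using int by (simp add: integrable_distr_eq)
  then have "(\<integral>x. (\<integral>y. h (x, y) \<partial>distr M N' Y) \<partial>distr M N X)
      = integral\<^sup>L (distr M N X \<Otimes>\<^sub>M distr M N' Y) h"
    by (rule XY.integral_fst')
  also have "\<dots> = (\<integral>\<omega>. h (X \<omega>, Y \<omega>) \<partial>M)"
    unfolding eq by (simp add: integral_distr)
  also have "(\<integral>x. (\<integral>y. h (x, y) \<partial>distr M N' Y) \<partial>distr M N X)
      = (\<integral>\<omega>. (\<integral>y. h (X \<omega>, y) \<partial>distr M N' Y) \<partial>M)"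
    by (subst integral_distr) auto
  also have "\<dots> = (\<integral>\<omega>. (\<integral>\<omega>'. h (X \<omega>, Y \<omega>') \<partial>M) \<partial>M)"
    by (intro Bochner_Integration.integral_cong refl, subst integral_distr)
      (auto intro: measurable_compose[OF measurable_Pair1'] dest: measurable_space[OF indep_var_rv1[OF ind]])
  finally show ?thesis ..
qed

section \<open>The risk of square-integrable data\<close>

locale square_integrable_data = prob_space D
  for D :: "((real ^ 'p) \<times> real) measure" +
  assumes data: "data_distribution D"
    and sq: "integrable D (\<lambda>(x, y). (norm x)\<^sup>2)"
begin

lemma sets_D: "sets D = sets (borel \<Otimes>\<^sub>M count_space {- 1, 1})"
  using data by (simp add: data_distribution_def labelled_space_def)

lemma space_D: "space D = UNIV \<times> {- 1, 1}"
  using sets_eq_imp_space_eq[OF sets_D] by (simp add: space_pair_measure)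

lemma abs_snd: "z \<in> space D \<Longrightarrow> \<bar>snd z\<bar> = 1"
  by (auto simp: space_D)

lemma measurable_fst_D [measurable]: "fst \<in> measurable D borel"
  unfolding measurable_cong_sets[OF sets_D refl] by (rule measurable_fst)

lemma measurable_snd_D [measurable]: "snd \<in> measurable D borel"
  unfolding measurable_cong_sets[OF sets_D refl]
  by (rule measurable_compose[OF measurable_snd]) simp

lemma measurable_sample_loss [measurable]:
  assumes [measurable]: "f \<in> measurable N D" "g \<in> measurable N borel"
  shows "(\<lambda>w. sample_loss (f w) (g w)) \<in> borel_measurable N"
  unfolding sample_loss_def by measurable

lemma measurable_stochastic_gradient [measurable]:
  assumes [measurable]: "f \<in> measurable N D" "g \<in> measurable N borel"
  shows "(\<lambda>w. stochastic_gradient (f w) (g w)) \<in> borel_measurable N"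
  unfolding stochastic_gradient_eq' by measurable

lemma measurable_logistic_risk [measurable]: "logistic_risk D \<in> borel_measurable borel"
proof -
  have "(\<lambda>\<beta>. \<integral>z. sample_loss z \<beta> \<partial>D) \<in> borel_measurable borel"
    by (rule borel_measurable_lebesgue_integral) measurable
  then show ?thesis
    by (simp add: logistic_risk_eq[abs_def])
qed

text \<open>The assumption covers exactly the samples drawn before step \<open>n\<close>, so the
  lemma applies both on the original probability space and on a finite product that carries only
  these samples.\<close>

lemma measurable_sgd:
  assumes "\<And>i. i < n \<Longrightarrow> (\<lambda>w. z w i) \<in> measurable N D"
  shows "(\<lambda>w. sgd \<alpha> (z w) n) \<in> borel_measurable N"
  using assms
proof (induction n)
  case (Suc n)
  then have [measurable]: "(\<lambda>w. z w n) \<in> measurable N D" "(\<lambda>w. sgd \<alpha> (z w) n) \<in> borel_measurable N"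
    by auto
  show ?case
    by simp
qed simp

lemma integrable_norm_sq: "integrable D (\<lambda>z. (norm (fst z))\<^sup>2)"
  using sq by (simp add: case_prod_beta')

lemma integrable_norm: "integrable D (\<lambda>z. norm (fst z))"
  by (rule square_integrable_imp_integrable[OF _ integrable_norm_sq]) measurable

lemma integrable_sample_loss: "integrable D (\<lambda>z. sample_loss z \<beta>)"
proof (rule Bochner_Integration.integrable_bound)
  show "integrable D (\<lambda>z. ln 2 + norm \<beta> * norm (fst z))"
    using integrable_norm by simp
  show "AE z in D. norm (sample_loss z \<beta>) \<le> norm (ln 2 + norm \<beta> * norm (fst z))"
    using sample_loss_le[OF abs_snd] by (auto simp: sample_loss_nonneg intro!: AE_I2)
qed measurable

lemma logistic_risk_nonneg: "0 \<le> logistic_risk D \<beta>"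
  unfolding logistic_risk_eq by (simp add: sample_loss_nonneg)

lemma logistic_risk_0: "logistic_risk D 0 = ln 2"
  by (simp add: logistic_risk_eq sample_loss_def logistic_loss_0 prob_space)

lemma logistic_risk_average:
  fixes b :: "nat \<Rightarrow> real ^ 'p"
  shows "logistic_risk D ((1 / (real k + 1)) *\<^sub>R (\<Sum>i=0..k. b i))
    \<le> (\<Sum>i=0..k. logistic_risk D (b i)) / (real k + 1)"
proof -
  have "logistic_risk D ((1 / (real k + 1)) *\<^sub>R (\<Sum>i=0..k. b i))
      \<le> (\<integral>z. (\<Sum>i=0..k. sample_loss z (b i)) / (real k + 1) \<partial>D)"
    unfolding logistic_risk_eq
    by (intro integral_mono integrable_sample_loss sample_loss_average)
      (auto intro!: integrable_sample_loss)
  also have "\<dots> = (\<Sum>i=0..k. logistic_risk D (b i)) / (real k + 1)"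
    by (simp add: logistic_risk_eq integrable_sample_loss)
  finally show ?thesis .
qed

lemma integrable_neg_part: "integrable D (\<lambda>z. neg_part (snd z * (\<beta> \<bullet> fst z)))"
proof (rule Bochner_Integration.integrable_bound[OF integrable_sample_loss[of \<beta>]])
  show "(\<lambda>z. neg_part (snd z * (\<beta> \<bullet> fst z))) \<in> borel_measurable D"
    unfolding neg_part_def by measurable
  show "AE z in D. norm (neg_part (snd z * (\<beta> \<bullet> fst z))) \<le> norm (sample_loss z \<beta>)"
    using neg_part_le_logistic_loss logistic_loss_nonneg
    by (auto simp: sample_loss_def neg_part_def)
qed

text \<open>The infimum is attained, hence it is itself the integral of a nonnegative
  function.\<close>

lemma DegNSEP_nonneg: "0 \<le> DegNSEP D"
proof -
  obtain \<beta> where "DegNSEP D = (\<integral>(x, y). neg_part (y * (\<beta> \<bullet> x)) \<partial>D)"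
    using DegNSEP_is_min[OF data sq] by metis
  then show ?thesis
    by (simp add: case_prod_beta' neg_part_def)
qed

text \<open>The expected negative part is positively homogeneous in the parameter, so its minimum
  over the unit sphere scales to every \<beta>; the logistic loss dominates the negative
  part.\<close>

lemma logistic_risk_ge_DegNSEP: "DegNSEP D * norm \<beta> \<le> logistic_risk D \<beta>"
proof (cases "\<beta> = 0")
  case False
  define \<gamma> where "\<gamma> = \<beta> /\<^sub>R norm \<beta>"
  have "norm \<gamma> = 1"
    using False by (simp add: \<gamma>_def)
  then have "DegNSEP D \<le> (\<integral>z. neg_part (snd z * (\<gamma> \<bullet> fst z)) \<partial>D)"
    using DegNSEP_is_min[OF data sq] by (metis (no_types, lifting) case_prod_beta' Bochner_Integration.integral_cong)
  then have "DegNSEP D * norm \<beta> \<le> (\<integral>z. neg_part (snd z * (\<gamma> \<bullet> fst z)) \<partial>D) * norm \<beta>"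
    by (rule mult_right_mono) simp
  also have "\<dots> = (\<integral>z. neg_part (snd z * (\<beta> \<bullet> fst z)) \<partial>D)"
  proof -
    have "neg_part (snd z * (\<beta> \<bullet> fst z)) = neg_part (snd z * (\<gamma> \<bullet> fst z)) * norm \<beta>" for z :: "(real ^ 'p) \<times> real"
    proof -
      have "snd z * (\<beta> \<bullet> fst z) = (snd z * (\<gamma> \<bullet> fst z)) * norm \<beta>"
        using False by (simp add: \<gamma>_def)
      then show ?thesis
        by (simp only: neg_part_def max_mult_distrib_right) simp
    qed
    then show ?thesis
      by simp
  qed
  also have "\<dots> \<le> logistic_risk D \<beta>"
    unfolding logistic_risk_eq
    by (intro integral_mono integrable_neg_part integrable_sample_loss)
      (simp add: sample_loss_def neg_part_le_logistic_loss)
  finally show ?thesis .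
qed (simp add: logistic_risk_nonneg)

text \<open>The trace is a bounded linear functional and so commutes with the Bochner integral once
  the matrix-valued integrand is integrable; pointwise it gives the squared norm.\<close>

lemma trace_second_moment: "trace (second_moment_matrix D) = (\<integral>z. (norm (fst z))\<^sup>2 \<partial>D)"
proof -
  define A where "A x = (\<chi> i j. x $ i * x $ j)" for x :: "real ^ 'p"
  \<comment> \<open>Row \<open>i\<close> of the rank-one matrix is \<open>x $ i\<close> times
    \<open>x\<close>, so the Frobenius norm factorises. Integrability of the matrix then follows
    from the second moment.\<close>
  have norm_A: "norm (A x) = (norm x)\<^sup>2" for x
  proof -
    have "A x = (\<chi> i. (x $ i) *\<^sub>R x)"
      by (simp add: A_def vec_eq_iff)
    then have "norm (A x) = L2_set (\<lambda>i. norm (x $ i) * norm x) UNIV"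
      by (simp only: norm_vec_def[of "\<chi> i. (x $ i) *\<^sub>R x"] vec_lambda_beta norm_scaleR real_norm_def)
    also have "\<dots> = L2_set (\<lambda>i. norm (x $ i)) UNIV * norm x"
      by (simp add: L2_set_left_distrib)
    finally show ?thesis
      by (simp add: norm_vec_def[of x] power2_eq_square)
  qed
  have [measurable]: "A \<in> borel_measurable borel"
    unfolding A_def by (intro borel_measurable_continuous_onI continuous_intros)
  have int: "integrable D (\<lambda>z. A (fst z))"
    by (rule Bochner_Integration.integrable_bound[OF integrable_norm_sq]) (auto simp: norm_A)
  have bl: "bounded_linear (trace :: real ^ 'p ^ 'p \<Rightarrow> real)"
    unfolding trace_def
    by (intro bounded_linear_sum bounded_linear_compose[OF bounded_linear_vec_nth bounded_linear_vec_nth])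
  have "trace (second_moment_matrix D) = (\<integral>z. trace (A (fst z)) \<partial>D)"
    using integral_bounded_linear[OF bl int]
    by (simp add: second_moment_matrix_def A_def case_prod_beta')
  also have "\<dots> = (\<integral>z. (norm (fst z))\<^sup>2 \<partial>D)"
    by (simp add: trace_def A_def power2_norm_eq_inner inner_vec_def)
  finally show ?thesis .
qed

end

section \<open>Iterates driven by independent samples\<close>

locale logistic_sgd = square_integrable_data D + P: prob_space P
  for D :: "((real ^ 'p) \<times> real) measure" and P :: "'w measure" +
  fixes Z :: "nat \<Rightarrow> 'w \<Rightarrow> (real ^ 'p) \<times> real" and \<alpha> :: real
  assumes iid: "iid_samples P D Z"
    and step_pos: "\<alpha> > 0"
begin

abbreviation iterate :: "nat \<Rightarrow> 'w \<Rightarrow> real ^ 'p" where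
  "iterate i \<omega> \<equiv> sgd \<alpha> (\<lambda>j. Z j \<omega>) i"

lemma indep_Z: "P.indep_vars (\<lambda>_. D) Z UNIV"
  and distr_Z: "distr P D (Z i) = D"
  using iid by (auto simp: iid_samples_def)

lemma measurable_Z [measurable]: "Z i \<in> measurable P D"
  using indep_Z by (auto simp: P.indep_vars_def)

lemma abs_snd_Z: "\<omega> \<in> space P \<Longrightarrow> \<bar>snd (Z i \<omega>)\<bar> = 1"
  by (rule abs_snd) (rule measurable_space[OF measurable_Z])

lemma measurable_iterate [measurable]: "iterate i \<in> borel_measurable P"
  by (rule measurable_sgd) measurable

lemma integral_Z:
  fixes f :: "(real ^ 'p) \<times> real \<Rightarrow> real"
  assumes "f \<in> borel_measurable D"
  shows "(\<integral>\<omega>. f (Z i \<omega>) \<partial>P) = (\<integral>z. f z \<partial>D)"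
  using integral_distr[OF measurable_Z assms, of i] by (simp add: distr_Z)

lemma integrable_Z:
  fixes f :: "(real ^ 'p) \<times> real \<Rightarrow> real"
  assumes "integrable D f"
  shows "integrable P (\<lambda>\<omega>. f (Z i \<omega>))"
  by (rule integrable_distr[OF measurable_Z]) (simp add: distr_Z assms)

lemma integrable_norm_iterate: "integrable P (\<lambda>\<omega>. norm (iterate i \<omega>))"
proof (rule Bochner_Integration.integrable_bound)
  show "integrable P (\<lambda>\<omega>. \<alpha> * (\<Sum>j<i. norm (fst (Z j \<omega>))))"
    by (auto intro!: integrable_Z[OF integrable_norm])
  show "AE \<omega> in P. norm (norm (iterate i \<omega>)) \<le> norm (\<alpha> * (\<Sum>j<i. norm (fst (Z j \<omega>))))"
  proof (rule AE_I2)
    fix \<omega>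
    assume "\<omega> \<in> space P"
    from norm_sgd_le[OF step_pos abs_snd_Z[OF this], of "\<lambda>j. j" i]
    show "norm (norm (iterate i \<omega>)) \<le> norm (\<alpha> * (\<Sum>j<i. norm (fst (Z j \<omega>))))"
      by simp
  qed
qed measurable

lemma integrable_risk_iterate: "integrable P (\<lambda>\<omega>. logistic_risk D (iterate i \<omega>))"
proof (rule Bochner_Integration.integrable_bound)
  define K where "K = (\<integral>z. norm (fst z) \<partial>D)"
  show "integrable P (\<lambda>\<omega>. ln 2 + norm (iterate i \<omega>) * K)"
    using integrable_norm_iterate by simp
  \<comment> \<open>The risk inherits linear growth from the loss, which reduces the claim to
    integrability of the norm of the iterate.\<close>
  have "logistic_risk D \<beta> \<le> ln 2 + norm \<beta> * K" for \<beta>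
  proof -
    have "logistic_risk D \<beta> \<le> (\<integral>z. ln 2 + norm \<beta> * norm (fst z) \<partial>D)"
      unfolding logistic_risk_eq
      by (intro integral_mono integrable_sample_loss sample_loss_le abs_snd)
        (auto intro!: integrable_norm)
    then show ?thesis
      using integrable_norm by (simp add: K_def prob_space)
  qed
  then show "AE \<omega> in P. norm (logistic_risk D (iterate i \<omega>)) \<le> norm (ln 2 + norm (iterate i \<omega>) * K)"
    by (auto intro!: AE_I2 simp: logistic_risk_nonneg intro: order_trans[OF _ abs_ge_self])
qed measurable

text \<open>The loss grows like the product of the norms of the iterate and of the current feature.
  Bounding the former by earlier feature norms leaves pairwise products, which second moments
  dominate.\<close>

lemma integrable_loss_iterate: "integrable P (\<lambda>\<omega>. sample_loss (Z i \<omega>) (iterate i \<omega>))"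
proof (rule Bochner_Integration.integrable_bound)
  let ?x = "\<lambda>j \<omega>. norm (fst (Z j \<omega>))"
  show "integrable P (\<lambda>\<omega>. ln 2 + \<alpha> * (\<Sum>j<i. (?x j \<omega>)\<^sup>2 + (?x i \<omega>)\<^sup>2))"
    by (intro Bochner_Integration.integrable_add Bochner_Integration.integrable_sum
        integrable_mult_right P.integrable_const
        integrable_Z[OF integrable_norm_sq])
  have "sample_loss (Z i \<omega>) (iterate i \<omega>) \<le> ln 2 + \<alpha> * (\<Sum>j<i. (?x j \<omega>)\<^sup>2 + (?x i \<omega>)\<^sup>2)"
    if "\<omega> \<in> space P" for \<omega>
  proof -
    have "sample_loss (Z i \<omega>) (iterate i \<omega>) \<le> ln 2 + norm (iterate i \<omega>) * ?x i \<omega>"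
      by (rule sample_loss_le[OF abs_snd_Z[OF that]])
    also have "norm (iterate i \<omega>) * ?x i \<omega> \<le> (\<alpha> * (\<Sum>j<i. ?x j \<omega>)) * ?x i \<omega>"
      by (intro mult_right_mono norm_sgd_le step_pos abs_snd_Z that) simp
    also have "\<dots> = \<alpha> * (\<Sum>j<i. ?x j \<omega> * ?x i \<omega>)"
      by (simp add: sum_distrib_right)
    also have "\<dots> \<le> \<alpha> * (\<Sum>j<i. (?x j \<omega>)\<^sup>2 + (?x i \<omega>)\<^sup>2)"
    proof (intro mult_left_mono sum_mono)
      fix j
      \<comment> \<open>The square gives twice the product as a lower bound for the sum of squares;
        as the product is nonnegative, one copy of it can be discarded.\<close>
      have "0 \<le> (?x j \<omega> - ?x i \<omega>)\<^sup>2" "0 \<le> ?x j \<omega> * ?x i \<omega>"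
        by auto
      then show "?x j \<omega> * ?x i \<omega> \<le> (?x j \<omega>)\<^sup>2 + (?x i \<omega>)\<^sup>2"
        unfolding power2_diff by linarith
    qed (use step_pos in simp)
    finally show ?thesis
      by simp
  qed
  then show "AE \<omega> in P. norm (sample_loss (Z i \<omega>) (iterate i \<omega>))
      \<le> norm (ln 2 + \<alpha> * (\<Sum>j<i. (?x j \<omega>)\<^sup>2 + (?x i \<omega>)\<^sup>2))"
    by (auto intro!: AE_I2 simp: sample_loss_nonneg intro: order_trans[OF _ abs_ge_self])
qed measurable

text \<open>Iterate \<open>i\<close> depends on samples before \<open>i\<close> only, so sample
  \<open>i\<close> can be integrated out with the iterate held fixed.\<close>

lemma expected_loss_iterate:
  "(\<integral>\<omega>. sample_loss (Z i \<omega>) (iterate i \<omega>) \<partial>P) = (\<integral>\<omega>. logistic_risk D (iterate i \<omega>) \<partial>P)"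
proof -
  \<comment> \<open>Past and present samples are both encoded as functions on the naturals, since
    \<open>indep_var\<close> needs one common value type.\<close>
  define h :: "(nat \<Rightarrow> (real ^ 'p) \<times> real) \<times> (nat \<Rightarrow> (real ^ 'p) \<times> real) \<Rightarrow> real"
    where "h = (\<lambda>(u, v). sample_loss (v i) (sgd \<alpha> u i))"
  define X where "X = (\<lambda>\<omega>. \<lambda>j\<in>{..<i}. Z j \<omega>)"
  define Y where "Y = (\<lambda>\<omega>. \<lambda>j\<in>{i}. Z j \<omega>)"
  have ind: "P.indep_var (PiM {..<i} (\<lambda>_. D)) X (PiM {i} (\<lambda>_. D)) Y"
    unfolding X_def Y_def by (rule P.indep_var_restrict[OF indep_Z]) auto
  \<comment> \<open>The restrictions are harmless: \<open>h\<close> reads its first argument only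
    below \<open>i\<close> and its second only at \<open>i\<close>.\<close>
  have h: "h (X \<omega>, Y \<omega>') = sample_loss (Z i \<omega>') (iterate i \<omega>)" for \<omega> \<omega>'
    unfolding h_def X_def Y_def by (simp cong: sgd_cong)
  have "(\<lambda>w. sgd \<alpha> (fst w) i) \<in> borel_measurable (PiM {..<i} (\<lambda>_. D) \<Otimes>\<^sub>M PiM {i} (\<lambda>_. D))"
    by (rule measurable_sgd) measurable
  moreover have "(\<lambda>w. snd w i) \<in> measurable (PiM {..<i} (\<lambda>_. D) \<Otimes>\<^sub>M PiM {i} (\<lambda>_. D)) D"
    by measurable
  ultimately have "h \<in> borel_measurable (PiM {..<i} (\<lambda>_. D) \<Otimes>\<^sub>M PiM {i} (\<lambda>_. D))"
    unfolding h_def case_prod_beta' by (rule measurable_sample_loss[rotated])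
  from P.integral_indep_var_pair[OF ind this] integrable_loss_iterate[of i]
  have "(\<integral>\<omega>. sample_loss (Z i \<omega>) (iterate i \<omega>) \<partial>P)
      = (\<integral>\<omega>. (\<integral>\<omega>'. sample_loss (Z i \<omega>') (iterate i \<omega>) \<partial>P) \<partial>P)"
    by (simp add: h)
  moreover have "(\<integral>\<omega>'. sample_loss (Z i \<omega>') \<beta> \<partial>P) = logistic_risk D \<beta>" for \<beta>
    unfolding logistic_risk_eq by (rule integral_Z) measurable
  ultimately show ?thesis
    by simp
qed

section \<open>The average expected risk of the iterates\<close>

text \<open>The quantity common to both outputs: it equals the expected risk at the random index and
  bounds that of the averaged iterate.\<close>

definition average_risk :: "nat \<Rightarrow> real" where
  "average_risk k = (\<Sum>i=0..k. \<integral>\<omega>. logistic_risk D (iterate i \<omega>) \<partial>P) / (real k + 1)"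

lemma average_risk_le:
  "average_risk k \<le> logistic_risk D \<gamma> + (norm \<gamma>)\<^sup>2 / (2 * \<alpha> * (real k + 1))
    + \<alpha> * trace (second_moment_matrix D) / 2"
proof -
  let ?T = "trace (second_moment_matrix D)"
  have intl: "integrable P (\<lambda>\<omega>. sample_loss (Z i \<omega>) \<gamma>)" for i
    by (rule integrable_Z[OF integrable_sample_loss])
  have ints: "integrable P (\<lambda>\<omega>. (norm (fst (Z i \<omega>)))\<^sup>2)" for i
    by (rule integrable_Z[OF integrable_norm_sq])
  have El: "(\<integral>\<omega>. sample_loss (Z i \<omega>) \<gamma> \<partial>P) = logistic_risk D \<gamma>" for i
    unfolding logistic_risk_eq by (rule integral_Z) measurable
  have Es: "(\<integral>\<omega>. (norm (fst (Z i \<omega>)))\<^sup>2 \<partial>P) = ?T" for i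
    unfolding trace_second_moment by (rule integral_Z) measurable
  have "(\<integral>\<omega>. 2 * \<alpha> * (\<Sum>i<Suc k. sample_loss (Z i \<omega>) (iterate i \<omega>) - sample_loss (Z i \<omega>) \<gamma>) \<partial>P)
      \<le> (\<integral>\<omega>. (norm \<gamma>)\<^sup>2 + \<alpha>\<^sup>2 * (\<Sum>i<Suc k. (norm (fst (Z i \<omega>)))\<^sup>2) \<partial>P)"
  proof (rule integral_mono)
    fix \<omega>
    assume "\<omega> \<in> space P"
    then show "2 * \<alpha> * (\<Sum>i<Suc k. sample_loss (Z i \<omega>) (iterate i \<omega>) - sample_loss (Z i \<omega>) \<gamma>)
        \<le> (norm \<gamma>)\<^sup>2 + \<alpha>\<^sup>2 * (\<Sum>i<Suc k. (norm (fst (Z i \<omega>)))\<^sup>2)"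
      \<comment> \<open>\<open>Suc k\<close> counts the samples \<open>0\<close> to
        \<open>k\<close>; the squared final distance is nonnegative and is dropped.\<close>
      using sgd_telescope[of \<alpha> "\<lambda>i. Z i \<omega>" \<gamma> "Suc k"] step_pos abs_snd_Z[of \<omega>]
      by (smt (verit) zero_le_power2)
  qed (intro Bochner_Integration.integrable_add Bochner_Integration.integrable_diff
      Bochner_Integration.integrable_sum integrable_mult_right integrable_loss_iterate
      intl ints P.integrable_const)+
  \<comment> \<open>Expectations turn losses at the iterates into expected risks, losses at \<gamma>
    into its risk, and squared feature norms into the trace.\<close>
  then have "2 * \<alpha> * ((\<Sum>i=0..k. \<integral>\<omega>. logistic_risk D (iterate i \<omega>) \<partial>P)
        - (real k + 1) * logistic_risk D \<gamma>)
      \<le> (norm \<gamma>)\<^sup>2 + \<alpha>\<^sup>2 * ((real k + 1) * ?T)"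
    by (simp add: integrable_loss_iterate intl ints El Es expected_loss_iterate P.prob_space
        sum_subtractf lessThan_Suc_atMost atMost_atLeast0 add.commute del: sum.lessThan_Suc)
  moreover define K where "K = real k + 1"
  moreover from this have "0 < K"
    by simp
  moreover from this have
    "(\<Sum>i=0..k. \<integral>\<omega>. logistic_risk D (iterate i \<omega>) \<partial>P) = K * average_risk k"
    by (simp add: average_risk_def K_def)
  ultimately have "(2 * \<alpha> * K) * average_risk k
      \<le> 2 * \<alpha> * K * logistic_risk D \<gamma> + (norm \<gamma>)\<^sup>2 + \<alpha>\<^sup>2 * K * ?T"
    by (simp only: right_diff_distrib mult.assoc)
  then have "average_risk k
      \<le> (2 * \<alpha> * K * logistic_risk D \<gamma> + (norm \<gamma>)\<^sup>2 + \<alpha>\<^sup>2 * K * ?T) / (2 * \<alpha> * K)"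
    using step_pos \<open>0 < K\<close> by (simp add: pos_le_divide_eq mult.commute)
  also have "\<dots> = logistic_risk D \<gamma> + (norm \<gamma>)\<^sup>2 / (2 * \<alpha> * K) + \<alpha> * ?T / 2"
    using step_pos \<open>0 < K\<close> by (simp add: add_divide_distrib power2_eq_square)
  finally show ?thesis
    by (simp only: K_def)
qed

text \<open>The bound is shown against the risk of every \<beta> and then passes to the infimum. A
  risk of at most \<open>ln 2\<close> confines \<beta> to the ball of radius
  \<open>ln 2 / DegNSEP D\<close>.\<close>

lemma average_risk_excess_le:
  assumes "0 < DegNSEP D"
  shows "average_risk k - optimal_logistic_risk D
    \<le> (ln 2)\<^sup>2 / (2 * \<alpha> * (real k + 1) * (DegNSEP D)\<^sup>2) + \<alpha> * trace (second_moment_matrix D) / 2"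
    (is "_ \<le> ?B + ?V")
proof -
  have "average_risk k - (?B + ?V) \<le> logistic_risk D \<beta>" for \<beta>
  proof (cases "logistic_risk D \<beta> \<le> ln 2")
    case True
    then have "norm \<beta> * DegNSEP D \<le> ln 2"
      using logistic_risk_ge_DegNSEP[of \<beta>] by (simp add: mult.commute)
    then have "(norm \<beta> * DegNSEP D)\<^sup>2 \<le> (ln 2)\<^sup>2"
      using assms by (intro power_mono) auto
    then have "(norm \<beta>)\<^sup>2 \<le> (ln 2)\<^sup>2 / (DegNSEP D)\<^sup>2"
      using assms by (simp add: pos_le_divide_eq power_mult_distrib)
    then have "(norm \<beta>)\<^sup>2 / (2 * \<alpha> * (real k + 1)) \<le> (ln 2)\<^sup>2 / (DegNSEP D)\<^sup>2 / (2 * \<alpha> * (real k + 1))"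
      using step_pos by (intro divide_right_mono) auto
    then show ?thesis
      using average_risk_le[of k \<beta>] by (simp add: mult_ac)
  next
    case False
    moreover have "0 \<le> ?B"
      using step_pos by simp
    ultimately show ?thesis
      \<comment> \<open>The origin has norm 0 and risk \<open>ln 2\<close>, which here lies below
        the risk of \<beta>.\<close>
      using average_risk_le[of k 0] by (simp add: logistic_risk_0)
  qed
  then have "average_risk k - (?B + ?V) \<le> optimal_logistic_risk D"
    unfolding optimal_logistic_risk_def by (intro cINF_greatest) auto
  then show ?thesis
    by simp
qed

text \<open>For \<open>DegNSEP D = 0\<close> the right-hand side is infinite; otherwise the
  extended-real bound is the real one.\<close>

lemma average_risk_excess_le_sgd_bound:
  "ereal (average_risk k - optimal_logistic_risk D) \<le> sgd_bound D \<alpha> k"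
proof (cases "DegNSEP D = 0")
  case False
  then have "0 < DegNSEP D"
    using DegNSEP_nonneg by simp
  then show ?thesis
    using average_risk_excess_le[of k] step_pos by (simp add: sgd_bound_def)
qed (simp add: sgd_bound_infinite)

section \<open>The averaged iterate and the random index\<close>

lemma expected_risk_average_le:
  "(\<integral>\<omega>. logistic_risk D (sgd_average \<alpha> (\<lambda>i. Z i \<omega>) k) \<partial>P) \<le> average_risk k"
proof -
  have "(\<integral>\<omega>. logistic_risk D (sgd_average \<alpha> (\<lambda>i. Z i \<omega>) k) \<partial>P)
      \<le> (\<integral>\<omega>. (\<Sum>i=0..k. logistic_risk D (iterate i \<omega>)) / (real k + 1) \<partial>P)"
    unfolding sgd_average_def
    \<comment> \<open>Jensen's inequality holds along each path; \<open>integral_mono'\<close> asks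
      for an integrable and nonnegative majorant.\<close>
    by (intro integral_mono' logistic_risk_average)
      (auto intro!: integrable_risk_iterate divide_nonneg_nonneg sum_nonneg logistic_risk_nonneg)
  also have "\<dots> = average_risk k"
    by (simp add: average_risk_def integrable_risk_iterate)
  finally show ?thesis .
qed

text \<open>Both variables are measurable with respect to the independent sigma-algebras in
  \<open>uniform_index\<close>. Taking real-valued functions of the iterate and of the index gives
  them the common type that \<open>indep_var\<close> requires.\<close>

lemma indep_var_iterate_index:
  assumes unif: "uniform_index P iterate k I" and "i \<le> k"
  shows "P.indep_var borel (\<lambda>\<omega>. logistic_risk D (iterate i \<omega>)) borel (\<lambda>\<omega>. indicator {i} (I \<omega>) :: real)"
proof -
  let ?F = "\<lambda>\<omega>. \<lambda>i\<in>{0..k}. iterate i \<omega>"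
  let ?VF = "vimage_algebra (space P) ?F (Pi\<^sub>M {0..k} (\<lambda>_. borel))"
  let ?VI = "vimage_algebra (space P) I (count_space UNIV)"
  have [measurable]: "I \<in> measurable P (count_space UNIV)"
    and ind: "P.indep_set (sets ?VF) (sets ?VI)"
    using unif by (auto simp: uniform_index_def)
  have "?F \<in> measurable ?VF (Pi\<^sub>M {0..k} (\<lambda>_. borel))"
    by (rule measurable_vimage_algebra1) (auto simp: space_PiM)
  then have "(\<lambda>\<omega>. ?F \<omega> i) \<in> measurable ?VF borel"
    by (rule measurable_compose) (use \<open>i \<le> k\<close> in simp)
  \<comment> \<open>Measurability is needed for the sigma-algebra generated by iterates
    \<open>0\<close> to \<open>k\<close>, not just for that of \<open>P\<close>.\<close>
  then have [measurable]: "iterate i \<in> measurable ?VF borel"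
    using \<open>i \<le> k\<close> by simp
  have "(\<lambda>\<omega>. logistic_risk D (iterate i \<omega>)) \<in> borel_measurable ?VF"
    by measurable
  then have 1: "sigma_sets (space P) {(\<lambda>\<omega>. logistic_risk D (iterate i \<omega>)) -` A \<inter> space P | A. A \<in> sets borel}
      \<subseteq> sets ?VF"
    by (rule sigma_sets_vimage_subset[of _ ?VF, unfolded space_vimage_algebra])
  have "I \<in> measurable ?VI (count_space UNIV)"
    by (rule measurable_vimage_algebra1) auto
  then have "(\<lambda>\<omega>. indicator {i} (I \<omega>) :: real) \<in> borel_measurable ?VI"
    by (rule measurable_compose) simp
  then have 2: "sigma_sets (space P) {(\<lambda>\<omega>. indicator {i} (I \<omega>) :: real) -` A \<inter> space P | A. A \<in> sets borel}
      \<subseteq> sets ?VI"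
    by (rule sigma_sets_vimage_subset[of _ ?VI, unfolded space_vimage_algebra])
  show ?thesis
    unfolding P.indep_var_eq
  proof (intro conjI)
    show "P.indep_set
        (sigma_sets (space P) {(\<lambda>\<omega>. logistic_risk D (iterate i \<omega>)) -` A \<inter> space P | A. A \<in> sets borel})
        (sigma_sets (space P) {(\<lambda>\<omega>. indicator {i} (I \<omega>) :: real) -` A \<inter> space P | A. A \<in> sets borel})"
      \<comment> \<open>Independence passes to subfamilies of events.\<close>
      using ind 1 2 unfolding P.indep_sets2_eq by (meson subset_eq)
    show "(\<lambda>\<omega>. indicator {i} (I \<omega>) :: real) \<in> borel_measurable P"
      by (rule measurable_compose[of I P "count_space UNIV"]) auto
  qed measurable
qed

text \<open>The risk at the random index is split by the value of the index; independence factorises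
  each expectation, and each value has probability \<open>1 / (real k + 1)\<close>.\<close>

lemma expected_risk_uniform_index:
  assumes unif: "uniform_index P iterate k I"
  shows "(\<integral>\<omega>. logistic_risk D (iterate (I \<omega>) \<omega>) \<partial>P) = average_risk k"
proof -
  have [measurable]: "I \<in> measurable P (count_space UNIV)"
    and dI: "distr P (count_space UNIV) I = measure_pmf (pmf_of_set {0..k})"
    using unif by (auto simp: uniform_index_def)
  have "AE j in measure_pmf (pmf_of_set {0..k}). j \<le> k"
    by (auto simp: AE_measure_pmf_iff)
  \<comment> \<open>The law of \<open>I\<close> confines it to \<open>{0..k}\<close> only up to a
    null set, so the splitting below holds almost everywhere.\<close>
  then have ae: "AE \<omega> in P. I \<omega> \<le> k"
    unfolding dI[symmetric] by (subst (asm) AE_distr_iff) auto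
  have Ei: "(\<integral>\<omega>. indicator {i} (I \<omega>) \<partial>P) = 1 / (real k + 1)" if "i \<le> k" for i
  proof -
    have "(\<integral>\<omega>. indicator {i} (I \<omega>) \<partial>P) = (\<integral>j. (indicator {i} j :: real) \<partial>distr P (count_space UNIV) I)"
      by (subst integral_distr) auto
    also have "\<dots> = 1 / (real k + 1)"
      unfolding dI using that by (simp add: measure_pmf_single)
    finally show ?thesis .
  qed
  have [measurable]: "(\<lambda>\<omega>. indicator {i} (I \<omega>) :: real) \<in> borel_measurable P" for i
    by (rule measurable_compose[of I P "count_space UNIV"]) auto
  have int: "integrable P (\<lambda>\<omega>. indicator {i} (I \<omega>) :: real)" for i
    by (rule P.integrable_const_bound[of _ 1]) (auto simp: indicator_def)
  have "(\<integral>\<omega>. logistic_risk D (iterate (I \<omega>) \<omega>) \<partial>P)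
      = (\<integral>\<omega>. (\<Sum>i=0..k. logistic_risk D (iterate i \<omega>) * indicator {i} (I \<omega>)) \<partial>P)"
  proof (rule integral_cong_AE)
    show "AE \<omega> in P. logistic_risk D (iterate (I \<omega>) \<omega>)
        = (\<Sum>i=0..k. logistic_risk D (iterate i \<omega>) * indicator {i} (I \<omega>))"
      using ae by eventually_elim (simp add: indicator_def if_distrib sum.delta cong: if_cong)
  qed measurable
  also have "\<dots> = (\<Sum>i=0..k. \<integral>\<omega>. logistic_risk D (iterate i \<omega>) * indicator {i} (I \<omega>) \<partial>P)"
    by (rule Bochner_Integration.integral_sum)
      (auto intro!: P.indep_var_integrable indep_var_iterate_index[OF unif] integrable_risk_iterate int)
  also have "\<dots> = (\<Sum>i=0..k. (\<integral>\<omega>. logistic_risk D (iterate i \<omega>) \<partial>P) * (1 / (real k + 1)))"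
  proof (rule sum.cong)
    fix i
    assume "i \<in> {0..k}"
    then show "(\<integral>\<omega>. logistic_risk D (iterate i \<omega>) * indicator {i} (I \<omega>) \<partial>P)
        = (\<integral>\<omega>. logistic_risk D (iterate i \<omega>) \<partial>P) * (1 / (real k + 1))"
      using P.indep_var_lebesgue_integral[OF indep_var_iterate_index[OF unif, of i]
          integrable_risk_iterate int] Ei[of i] by simp
  qed simp
  also have "\<dots> = average_risk k"
    by (simp add: average_risk_def sum_divide_distrib)
  finally show ?thesis .
qed

end

theorem theorem4p2:
  fixes D :: "((real ^ 'p) \<times> real) measure"
    and P :: "'w measure"
    and Z :: "nat \<Rightarrow> 'w \<Rightarrow> (real ^ 'p) \<times> real"
    and \<alpha> :: real
  assumes "data_distribution D"
    and "integrable D (\<lambda>(x, y). (norm x)\<^sup>2)"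
    and "\<alpha> > 0"
    and "iid_samples P D Z"
    and "\<not> separable D"
  shows "\<forall>k.
    ereal ((\<integral>\<omega>. logistic_risk D (sgd_average \<alpha> (\<lambda>i. Z i \<omega>) k) \<partial>P) - optimal_logistic_risk D)
      \<le> sgd_bound D \<alpha> k \<and>
    (\<forall>I. uniform_index P (\<lambda>i \<omega>. sgd \<alpha> (\<lambda>j. Z j \<omega>) i) k I \<longrightarrow>
      ereal ((\<integral>\<omega>. logistic_risk D (sgd \<alpha> (\<lambda>i. Z i \<omega>) (I \<omega>)) \<partial>P) - optimal_logistic_risk D)
        \<le> sgd_bound D \<alpha> k)"
proof -
  interpret logistic_sgd D P Z \<alpha>
    using assms
    by (simp add: logistic_sgd_def logistic_sgd_axioms_def square_integrable_data_def
        square_integrable_data_axioms_def data_distribution_def iid_samples_def)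
  show ?thesis
  proof (intro allI conjI impI)
    fix k
    show "ereal ((\<integral>\<omega>. logistic_risk D (sgd_average \<alpha> (\<lambda>i. Z i \<omega>) k) \<partial>P) - optimal_logistic_risk D)
        \<le> sgd_bound D \<alpha> k"
      using expected_risk_average_le[of k]
      by (intro order_trans[OF _ average_risk_excess_le_sgd_bound]) simp
    fix I
    assume "uniform_index P (\<lambda>i \<omega>. sgd \<alpha> (\<lambda>j. Z j \<omega>) i) k I"
    from expected_risk_uniform_index[OF this]
    show "ereal ((\<integral>\<omega>. logistic_risk D (sgd \<alpha> (\<lambda>i. Z i \<omega>) (I \<omega>)) \<partial>P) - optimal_logistic_risk D)
        \<le> sgd_bound D \<alpha> k"
      using average_risk_excess_le_sgd_bound[of k] by simp
  qed
qed

end
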